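(* Let $(N,S)$ be a Nijenhuis structure on a LieYRep pair $((\mathfrak g,[\cdot,\cdot],[\![\cdot,\cdot,\cdot]\!]),(V;\rho,\mu))$. Then $N+S$, defined by $(N+S)(x+u)=Nx+Su$ for $x\in\mathfrak g$, $u\in V$, is a Nijenhuis operator on the semidirect product Lie-Yamaguti algebra $\mathfrak g\ltimes V$.
   Context: All vector spaces are finite-dimensional over a field $\mathbb K$ of characteristic $0$. A Lie-Yamaguti algebra is a vector space $\mathfrak g$ with a bilinear map $[\cdot,\cdot]:\wedge^2\mathfrak g\to\mathfrak g$ and a trilinear map $[\![\cdot,\cdot,\cdot]\!]:\wedge^2\mathfrak g\otimes\mathfrak g\to\mathfrak g$ such that for all $x,y,z,w,t\in\mathfrak g$: (1) $[[x,y],z]+[[y,z],x]+[[z,x],y]+[\![x,y,z]\!]+[\![y,z,x]\!]+[\![z,x,y]\!]=0$; (2) $[\![[x,y],z,w]\!]+[\![[y,z],x,w]\!]+[\![[z,x],y,w]\!]=0$; (3) $[\![x,y,[z,w]]\!]=[[\![x,y,z]\!],w]+[z,[\![x,y,w]\!]]$; (4) $[\![x,y,[\![z,w,t]\!]]\!]=[\![[\![x,y,z]\!],w,t]\!]+[\![z,[\![x,y,w]\!],t]\!]+[\![z,w,[\![x,y,t]\!]]\!]$. A representation $(V;\rho,\mu)$ of $\mathfrak g$ is a vector space $V$ with linear maps $\rho:\mathfrak g\to\mathfrak{gl}(V)$, $\mu:\otimes^2\mathfrak g\to\mathfrak{gl}(V)$ such that, with $D(x,y)=D_{\rho,\mu}(x,y):=\mu(y,x)-\mu(x,y)+[\rho(x),\rho(y)]-\rho([x,y])$,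 for all $x,y,z,w\in\mathfrak g$: $\mu([x,y],z)-\mu(x,z)\rho(y)+\mu(y,z)\rho(x)=0$; $\mu(x,[y,z])-\rho(y)\mu(x,z)+\rho(z)\mu(x,y)=0$; $\rho([\![x,y,z]\!])=[D(x,y),\rho(z)]$; $\mu(z,w)\mu(x,y)-\mu(y,w)\mu(x,z)-\mu(x,[\![y,z,w]\!])+D(y,z)\mu(x,w)=0$; $\mu([\![x,y,z]\!],w)+\mu(z,[\![x,y,w]\!])=[D(x,y),\mu(z,w)]$. A Lie-Yamaguti algebra together with a representation is called a LieYRep pair. Nijenhuis operator on a Lie-Yamaguti algebra: a linear map $N:\mathfrak g\to\mathfrak g$ such that, with $[x,y]_N=[Nx,y]+[x,Ny]-N[x,y]$ and $[\![x,y,z]\!]_N=[\![Nx,Ny,z]\!]+[\![x,Ny,Nz]\!]+[\![Nx,y,Nz]\!]-N([\![Nx,y,z]\!]+[\![x,Ny,z]\!]+[\![x,y,Nz]\!])+N^2[\![x,y,z]\!]$, one has $[Nx,Ny]=N[x,y]_N$ and $[\![Nx,Ny,Nz]\!]=N[\![x,y,z]\!]_N$ for all $x,y,z\in\mathfrak g$. Nijenhuis structure on a LieYRep pair: a pair $(N,S)$ with $N\in\mathfrak{gl}(\mathfrak g)$, $S\in\mathfrak{gl}(V)$ such that $N$ is a Nijenhuis operator on $\mathfrak g$ and for all $x,y\in\mathfrak g$: $\rho(Nx)\circ S=S\circ(\rho(Nx)+\rho(x)\circ S-S\circ\rho(x))$ and $\mu(Nx,Ny)\circ S=S\circ\big(\mu(Nx,y)\circ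 S+\mu(x,Ny)\circ S+\mu(Nx,Ny)-S\circ(\mu(Nx,y)+\mu(x,Ny)+\mu(x,y)\circ S)+S^2\circ\mu(x,y)\big)$. Semidirect product Lie-Yamaguti algebra $\mathfrak g\ltimes V$: $\mathfrak g\oplus V$ with $[x+u,y+v]_\ltimes=[x,y]+\rho(x)v-\rho(y)u$ and $[\![x+u,y+v,z+w]\!]_\ltimes=[\![x,y,z]\!]+D(x,y)w+\mu(y,z)u-\mu(x,z)v$. *)

theory Defs
  imports "HOL-Analysis.Product_Vector"
begin

text \<open>
  A vector space is a whole type together with a scalar multiplication, as in
  \<open>HOL.Vector_Spaces\<close>. The class \<open>field_char_0\<close> of the scalars is the standing
  assumption on the characteristic.
\<close>

locale fin_dim_space = vector_space scale
  for scale :: "'k::field_char_0 \<Rightarrow> 'a::ab_group_add \<Rightarrow> 'a" +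
  assumes ex_basis: "\<exists>B. finite_dimensional_vector_space scale B"

text \<open>
  \<open>br x y\<close> is the bilinear bracket $[x,y]$ and \<open>tri x y z\<close> the trilinear bracket
  $[\![x,y,z]\!]$. Being defined on $\wedge^2\mathfrak g$ means being alternating in the first
  two arguments.
\<close>

locale lie_yamaguti = fin_dim_space scale
  for scale :: "'k::field_char_0 \<Rightarrow> 'g::ab_group_add \<Rightarrow> 'g" +
  fixes br :: "'g \<Rightarrow> 'g \<Rightarrow> 'g"
    and tri :: "'g \<Rightarrow> 'g \<Rightarrow> 'g \<Rightarrow> 'g"
  assumes linear_br_left: "Vector_Spaces.linear scale scale (\<lambda>x. br x y)"
    and linear_br_right: "Vector_Spaces.linear scale scale (\<lambda>y. br x y)"
    and br_alt: "br x x = 0"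
    and linear_tri_1: "Vector_Spaces.linear scale scale (\<lambda>x. tri x y z)"
    and linear_tri_2: "Vector_Spaces.linear scale scale (\<lambda>y. tri x y z)"
    and linear_tri_3: "Vector_Spaces.linear scale scale (\<lambda>z. tri x y z)"
    and tri_alt: "tri x x z = 0"
    and br_br_cyclic:
      "br (br x y) z + br (br y z) x + br (br z x) y
        + tri x y z + tri y z x + tri z x y = 0"
    and tri_br_cyclic:
      "tri (br x y) z w + tri (br y z) x w + tri (br z x) y w = 0"
    and tri_br:
      "tri x y (br z w) = br (tri x y z) w + br z (tri x y w)"
    and tri_tri:
      "tri x y (tri z w t) = tri (tri x y z) w t + tri z (tri x y w) t + tri z w (tri x y t)"

text \<open>
  The operator $D_{\rho,\mu}(x,y) = \mu(y,x)-\mu(x,y)+[\rho(x),\rho(y)]-\rho([x,y])$,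
  where the bracket of the two endomorphisms is their commutator. Here and below, identities
  between endomorphisms of $V$ are evaluated at a vector \<open>v\<close>.
\<close>

definition rep_D ::
  "('g \<Rightarrow> 'g \<Rightarrow> 'g) \<Rightarrow> ('g \<Rightarrow> 'v \<Rightarrow> 'v) \<Rightarrow> ('g \<Rightarrow> 'g \<Rightarrow> 'v \<Rightarrow> 'v) \<Rightarrow>
    'g \<Rightarrow> 'g \<Rightarrow> 'v \<Rightarrow> 'v::ab_group_add" where
  "rep_D br rho mu x y v =
    mu y x v - mu x y v + (rho x (rho y v) - rho y (rho x v)) - rho (br x y) v"

locale lie_yrep_pair = lie_yamaguti sg br tri + V: fin_dim_space sv
  for sg :: "'k::field_char_0 \<Rightarrow> 'g::ab_group_add \<Rightarrow> 'g"
    and br :: "'g \<Rightarrow> 'g \<Rightarrow> 'g"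
    and tri :: "'g \<Rightarrow> 'g \<Rightarrow> 'g \<Rightarrow> 'g"
    and sv :: "'k \<Rightarrow> 'v::ab_group_add \<Rightarrow> 'v" +
  fixes rho :: "'g \<Rightarrow> 'v \<Rightarrow> 'v"
    and mu :: "'g \<Rightarrow> 'g \<Rightarrow> 'v \<Rightarrow> 'v"
  assumes linear_rho_arg: "Vector_Spaces.linear sg sv (\<lambda>x. rho x v)"
    and linear_rho: "Vector_Spaces.linear sv sv (rho x)"
    and linear_mu_arg_1: "Vector_Spaces.linear sg sv (\<lambda>x. mu x y v)"
    and linear_mu_arg_2: "Vector_Spaces.linear sg sv (\<lambda>y. mu x y v)"
    and linear_mu: "Vector_Spaces.linear sv sv (mu x y)"
    and mu_br_left:
      "mu (br x y) z v - mu x z (rho y v) + mu y z (rho x v) = 0"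
    and mu_br_right:
      "mu x (br y z) v - rho y (mu x z v) + rho z (mu x y v) = 0"
    and rho_tri:
      "rho (tri x y z) v = rep_D br rho mu x y (rho z v) - rho z (rep_D br rho mu x y v)"
    and mu_mu:
      "mu z w (mu x y v) - mu y w (mu x z v) - mu x (tri y z w) v
        + rep_D br rho mu y z (mu x w v) = 0"
    and mu_tri:
      "mu (tri x y z) w v + mu z (tri x y w) v
        = rep_D br rho mu x y (mu z w v) - mu z w (rep_D br rho mu x y v)"

definition deformed_br :: "('g \<Rightarrow> 'g \<Rightarrow> 'g) \<Rightarrow> ('g \<Rightarrow> 'g) \<Rightarrow> 'g \<Rightarrow> 'g \<Rightarrow> 'g::ab_group_add" where
  "deformed_br br N x y = br (N x) y + br x (N y) - N (br x y)"

definition deformed_tri ::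
  "('g \<Rightarrow> 'g \<Rightarrow> 'g \<Rightarrow> 'g) \<Rightarrow> ('g \<Rightarrow> 'g) \<Rightarrow> 'g \<Rightarrow> 'g \<Rightarrow> 'g \<Rightarrow> 'g::ab_group_add" where
  "deformed_tri tri N x y z =
    tri (N x) (N y) z + tri x (N y) (N z) + tri (N x) y (N z)
    - N (tri (N x) y z + tri x (N y) z + tri x y (N z))
    + N (N (tri x y z))"

locale nijenhuis_operator = lie_yamaguti scale br tri
  for scale :: "'k::field_char_0 \<Rightarrow> 'g::ab_group_add \<Rightarrow> 'g"
    and br :: "'g \<Rightarrow> 'g \<Rightarrow> 'g"
    and tri :: "'g \<Rightarrow> 'g \<Rightarrow> 'g \<Rightarrow> 'g" +
  fixes N :: "'g \<Rightarrow> 'g"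
  assumes linear_N: "Vector_Spaces.linear scale scale N"
    and br_N: "br (N x) (N y) = N (deformed_br br N x y)"
    and tri_N: "tri (N x) (N y) (N z) = N (deformed_tri tri N x y z)"

locale nijenhuis_structure =
  lie_yrep_pair sg br tri sv rho mu + nijenhuis_operator sg br tri N
  for sg :: "'k::field_char_0 \<Rightarrow> 'g::ab_group_add \<Rightarrow> 'g"
    and br :: "'g \<Rightarrow> 'g \<Rightarrow> 'g"
    and tri :: "'g \<Rightarrow> 'g \<Rightarrow> 'g \<Rightarrow> 'g"
    and sv :: "'k \<Rightarrow> 'v::ab_group_add \<Rightarrow> 'v"
    and rho :: "'g \<Rightarrow> 'v \<Rightarrow> 'v"
    and mu :: "'g \<Rightarrow> 'g \<Rightarrow> 'v \<Rightarrow> 'v"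
    and N :: "'g \<Rightarrow> 'g" +
  fixes S :: "'v \<Rightarrow> 'v"
  assumes linear_S: "Vector_Spaces.linear sv sv S"
    and rho_N: "rho (N x) (S v) = S (rho (N x) v + rho x (S v) - S (rho x v))"
    and mu_N: "mu (N x) (N y) (S v) =
      S (mu (N x) y (S v) + mu x (N y) (S v) + mu (N x) (N y) v
        - S (mu (N x) y v + mu x (N y) v + mu x y (S v))
        + S (S (mu x y v)))"

text \<open>
  The semidirect product lives on the product type, the pair \<open>(x, u)\<close> standing for $x+u$;
  its scalar multiplication is \<open>module_prod.scale sg sv\<close>.
\<close>

fun semidirect_br ::
  "('g \<Rightarrow> 'g \<Rightarrow> 'g) \<Rightarrow> ('g \<Rightarrow> 'v \<Rightarrow> 'v) \<Rightarrow> 'g \<times> 'v \<Rightarrow> 'g \<times> 'v \<Rightarrow> 'g \<times> 'v::ab_group_add" where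
  "semidirect_br br rho (x, u) (y, v) = (br x y, rho x v - rho y u)"

fun semidirect_tri ::
  "('g \<Rightarrow> 'g \<Rightarrow> 'g) \<Rightarrow> ('g \<Rightarrow> 'g \<Rightarrow> 'g \<Rightarrow> 'g) \<Rightarrow> ('g \<Rightarrow> 'v \<Rightarrow> 'v) \<Rightarrow> ('g \<Rightarrow> 'g \<Rightarrow> 'v \<Rightarrow> 'v) \<Rightarrow>
    'g \<times> 'v \<Rightarrow> 'g \<times> 'v \<Rightarrow> 'g \<times> 'v \<Rightarrow> 'g \<times> 'v::ab_group_add" where
  "semidirect_tri br tri rho mu (x, u) (y, v) (z, w) =
    (tri x y z, rep_D br rho mu x y w + mu y z u - mu x z v)"

end

theory Submission
  imports Defs
begin

text \<open>
  Two things have to be shown: that the semidirect product satisfies the Lie-Yamaguti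
  identities, and that $N+S$ satisfies the two Nijenhuis identities on it. All identities
  involved are multilinear and the ideal $V$ multiplies trivially with itself, so each of them
  splits into its restriction to \<open>g\<close>, which is the same identity there, and one component for
  each position in which a single argument comes from $V$.

  For the Lie-Yamaguti identities most of these components are the axioms of a representation,
  or the definition of the operator $D$. When the argument from $V$ stands last, two of them are
  consequences of the axioms: the cyclic sum of $D([x,y],z)$ vanishes (\<open>D_br_cyclic\<close>, from the
  Jacobi identity for commutators), and $[D(x,y),D(z,w)]=D([\![x,y,z]\!],w)+D(z,[\![x,y,w]\!])$
  (\<open>D_derivation\<close>, because $D(x,y)$ acts as a derivation on every ingredient of $D(z,w)$).

  For the Nijenhuis identities, the components from $V$ of the binary one, and those of the
  ternary one in the first two positions, are the hypotheses on $\rho$ and $\mu$. The last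
  position requires for $D$ the same identity that is assumed for $\mu$. That identity makes
  sense for any operator-valued map $F(x,y)$ on \<open>g\<close>; it is preserved by linear combinations and
  by exchanging $x$ and $y$, and it holds for $\rho(x)\rho(y)$ and for $\rho([x,y])$. Since $D$ is
  a combination of $\mu$ and of these maps, it inherits the identity (\<open>compatible_D\<close>).
\<close>

section \<open>Linear maps and products of spaces\<close>

lemmas linear_map_rules =
  module_hom.add [OF module_hom_linearI] module_hom.diff [OF module_hom_linearI]
  module_hom.neg [OF module_hom_linearI] module_hom.zero [OF module_hom_linearI]
  module_hom.scale [OF module_hom_linearI]

lemma fin_dim_space_prod:
  assumes "fin_dim_space s1" and "fin_dim_space s2"
  shows "fin_dim_space (module_prod.scale s1 s2)"
proof -
  interpret s1: fin_dim_space s1 by fact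
  interpret s2: fin_dim_space s2 by fact
  interpret vector_space_prod s1 s2 ..
  obtain B1 where "finite_dimensional_vector_space s1 B1"
    using s1.ex_basis ..
  then interpret B1: finite_dimensional_vector_space s1 B1 .
  obtain B2 where "finite_dimensional_vector_space s2 B2"
    using s2.ex_basis ..
  then interpret B2: finite_dimensional_vector_space s2 B2 .
  interpret B: finite_dimensional_vector_space_prod s1 s2 B1 B2 ..
  show ?thesis
    by unfold_locales (use B.p.finite_dimensional_vector_space_axioms in blast)
qed

section \<open>The semidirect product\<close>

context lie_yrep_pair
begin

abbreviation D :: "'g \<Rightarrow> 'g \<Rightarrow> 'v \<Rightarrow> 'v" where
  "D \<equiv> rep_D br rho mu"

lemmas br_linear_rules =
  linear_map_rules [OF linear_br_left] linear_map_rules [OF linear_br_right]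

lemmas tri_linear_rules =
  linear_map_rules [OF linear_tri_1] linear_map_rules [OF linear_tri_2]
  linear_map_rules [OF linear_tri_3]

lemmas rho_linear_rules =
  linear_map_rules [OF linear_rho] linear_map_rules [OF linear_rho_arg]

lemmas mu_linear_rules =
  linear_map_rules [OF linear_mu] linear_map_rules [OF linear_mu_arg_1]
  linear_map_rules [OF linear_mu_arg_2]

lemma D_self: "D x x v = 0"
  by (simp add: rep_D_def br_alt rho_linear_rules)

lemma linear_D: "Vector_Spaces.linear sv sv (D x y)"
  by (simp add: Vector_Spaces.linear_iff V.vector_space_axioms rep_D_def rho_linear_rules
      mu_linear_rules V.scale_right_distrib V.scale_right_diff_distrib)

lemma linear_D_arg_1: "Vector_Spaces.linear sg sv (\<lambda>x. D x y v)"
  by (simp add: Vector_Spaces.linear_iff vector_space_axioms V.vector_space_axioms rep_D_def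
      rho_linear_rules mu_linear_rules br_linear_rules V.scale_right_distrib
      V.scale_right_diff_distrib)

lemma linear_D_arg_2: "Vector_Spaces.linear sg sv (\<lambda>y. D x y v)"
  by (simp add: Vector_Spaces.linear_iff vector_space_axioms V.vector_space_axioms rep_D_def
      rho_linear_rules mu_linear_rules br_linear_rules V.scale_right_distrib
      V.scale_right_diff_distrib)

lemmas D_linear_rules =
  linear_map_rules [OF linear_D] linear_map_rules [OF linear_D_arg_1]
  linear_map_rules [OF linear_D_arg_2]

text \<open>
  The next three facts are representation axioms, oriented as rewrite rules that remove brackets
  from the arguments of \<open>mu\<close>.
\<close>

lemma mu_of_br_left: "mu (br x y) z v = mu x z (rho y v) - mu y z (rho x v)"
  using mu_br_left [of x y z v] by (simp add: algebra_simps)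

lemma mu_of_br_right: "mu x (br y z) v = rho y (mu x z v) - rho z (mu x y v)"
  using mu_br_right [of x y z v] by (simp add: algebra_simps)

lemma mu_of_tri_right:
  "mu x (tri y z w) v = mu z w (mu x y v) - mu y w (mu x z v) + D y z (mu x w v)"
  using mu_mu [of z w x y v] by (simp add: algebra_simps)

text \<open>
  The brackets $\rho([[x,y],z])$ are traded for $[D(x,y),\rho(z)]$ by applying $\rho$ to the cyclic
  identity of \<open>g\<close>. After this, the triple products of $\rho$ cancel by the Jacobi identity for
  commutators, and the terms in $\mu$ cancel because the axioms for $\mu([x,y],z)$ and
  $\mu(z,[x,y])$ express both through products of $\rho$ and $\mu$.
\<close>

lemma D_br_cyclic: "D (br x y) z v + D (br y z) x v + D (br z x) y v = 0"
proof -
  have "rho (br (br x y) z + br (br y z) x + br (br z x) y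
      + tri x y z + tri y z x + tri z x y) v = 0"
    by (simp only: br_br_cyclic rho_linear_rules)
  then have "rho (br (br x y) z) v + rho (br (br y z) x) v + rho (br (br z x) y) v
      + (D x y (rho z v) - rho z (D x y v)) + (D y z (rho x v) - rho x (D y z v))
      + (D z x (rho y v) - rho y (D z x v)) = 0"
    by (simp only: rho_linear_rules rho_tri)
  then have rho_br_br: "rho (br (br x y) z) v = - (rho (br (br y z) x) v + rho (br (br z x) y) v
      + (D x y (rho z v) - rho z (D x y v)) + (D y z (rho x v) - rho x (D y z v))
      + (D z x (rho y v) - rho y (D z x v)))"
    by (simp only: eq_neg_iff_add_eq_0 add.assoc)
  show ?thesis
    unfolding rep_D_def [of br rho mu "br x y" z] rep_D_def [of br rho mu "br y z" x]
      rep_D_def [of br rho mu "br z x" y] rho_br_br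
    by (simp add: rep_D_def mu_of_br_left mu_of_br_right rho_linear_rules algebra_simps)
qed

text \<open>
  $D(x,y)$ commutes with $\rho$ and $\mu$ up to the action of $[\![x,y,\cdot]\!]$ on their
  arguments, and $[\![x,y,\cdot]\!]$ is a derivation of the bracket. As $D(z,w)$ is built from
  $\rho$, $\mu$ and the bracket, it obeys the same Leibniz rule.
\<close>

lemma D_derivation:
  "D x y (D z w v) = D (tri x y z) w v + D z (tri x y w) v + D z w (D x y v)"
proof -
  have D_rho: "D x y (rho a u) = rho (tri x y a) u + rho a (D x y u)" for a u
    by (simp add: rho_tri)
  have D_mu: "D x y (mu a b u) = mu (tri x y a) b u + mu a (tri x y b) u + mu a b (D x y u)"
    for a b u
    by (simp add: mu_tri)
  show ?thesis
    unfolding rep_D_def [of br rho mu z w] rep_D_def [of br rho mu "tri x y z" w]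
      rep_D_def [of br rho mu z "tri x y w"]
    by (simp add: D_linear_rules D_rho D_mu tri_br rho_linear_rules algebra_simps)
qed

text \<open>
  Comparing coefficients of the components \<open>a\<close>, \<open>b\<close>, \<open>c\<close>, \<open>d\<close>, \<open>e\<close> in $V$: the definition of $D$ gives
  the first cyclic identity, the axiom for $\mu([x,y],z)$ with \<open>D_br_cyclic\<close> the second one, and the
  axioms for $\mu(x,[y,z])$ and $\rho([\![x,y,z]\!])$ the derivation rule for the bracket. In the
  derivation rule for the triple bracket the first two arguments use \<open>mu_mu\<close>, the next two
  \<open>mu_tri\<close>, and the last one \<open>D_derivation\<close>.
\<close>

theorem lie_yamaguti_semidirect:
  "lie_yamaguti (module_prod.scale sg sv) (semidirect_br br rho) (semidirect_tri br tri rho mu)"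
proof -
  interpret vector_space_prod sg sv ..
  interpret P: fin_dim_space scale
    by (rule fin_dim_space_prod; unfold_locales)
  note pair_rules = Vector_Spaces.linear_iff p.vector_space_axioms scale_prod
    V.scale_right_distrib V.scale_right_diff_distrib
  show ?thesis
  proof (intro lie_yamaguti.intro lie_yamaguti_axioms.intro P.fin_dim_space_axioms)
    fix X Y Z W T :: "'g \<times> 'v"
    obtain x a where X: "X = (x, a)" by (cases X)
    obtain y b where Y: "Y = (y, b)" by (cases Y)
    obtain z c where Z: "Z = (z, c)" by (cases Z)
    obtain w d where W: "W = (w, d)" by (cases W)
    obtain t e where T: "T = (t, e)" by (cases T)
    note components = X Y Z W T
    show "Vector_Spaces.linear scale scale (\<lambda>X. semidirect_br br rho X Y)"
      by (auto simp: Y pair_rules br_linear_rules rho_linear_rules)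
    show "Vector_Spaces.linear scale scale (\<lambda>Y. semidirect_br br rho X Y)"
      by (auto simp: X pair_rules br_linear_rules rho_linear_rules)
    show "Vector_Spaces.linear scale scale (\<lambda>X. semidirect_tri br tri rho mu X Y Z)"
      by (auto simp: Y Z pair_rules tri_linear_rules mu_linear_rules D_linear_rules)
    show "Vector_Spaces.linear scale scale (\<lambda>Y. semidirect_tri br tri rho mu X Y Z)"
      by (auto simp: X Z pair_rules tri_linear_rules mu_linear_rules D_linear_rules)
    show "Vector_Spaces.linear scale scale (\<lambda>Z. semidirect_tri br tri rho mu X Y Z)"
      by (auto simp: X Y pair_rules tri_linear_rules mu_linear_rules D_linear_rules)
    show "semidirect_br br rho X X = 0"
      by (simp add: X br_alt zero_prod_def)
    show "semidirect_tri br tri rho mu X X Z = 0"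
      by (simp add: X Z tri_alt D_self zero_prod_def)
    show "semidirect_br br rho (semidirect_br br rho X Y) Z
        + semidirect_br br rho (semidirect_br br rho Y Z) X
        + semidirect_br br rho (semidirect_br br rho Z X) Y
        + semidirect_tri br tri rho mu X Y Z
        + semidirect_tri br tri rho mu Y Z X
        + semidirect_tri br tri rho mu Z X Y = 0"
      by (simp add: components br_br_cyclic rep_D_def rho_linear_rules zero_prod_def)
    show "semidirect_tri br tri rho mu (semidirect_br br rho X Y) Z W
        + semidirect_tri br tri rho mu (semidirect_br br rho Y Z) X W
        + semidirect_tri br tri rho mu (semidirect_br br rho Z X) Y W = 0"
      using D_br_cyclic [of x y z d]
      by (simp add: components tri_br_cyclic mu_of_br_left mu_linear_rules zero_prod_def)
    show "semidirect_tri br tri rho mu X Y (semidirect_br br rho Z W)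
        = semidirect_br br rho (semidirect_tri br tri rho mu X Y Z) W
          + semidirect_br br rho Z (semidirect_tri br tri rho mu X Y W)"
      by (simp add: components tri_br rho_tri mu_of_br_right rho_linear_rules D_linear_rules
          algebra_simps)
    show "semidirect_tri br tri rho mu X Y (semidirect_tri br tri rho mu Z W T)
        = semidirect_tri br tri rho mu (semidirect_tri br tri rho mu X Y Z) W T
          + semidirect_tri br tri rho mu Z (semidirect_tri br tri rho mu X Y W) T
          + semidirect_tri br tri rho mu Z W (semidirect_tri br tri rho mu X Y T)"
    proof -
      have D_mu: "D x y (mu p q v)
          = mu (tri x y p) q v + mu p (tri x y q) v + mu p q (D x y v)" for p q v
        by (simp add: mu_tri)
      have "D x y (D z w e + mu w t c - mu z t d) + mu y (tri z w t) a - mu x (tri z w t) b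
          = (D (tri x y z) w e + mu w t (D x y c + mu y z a - mu x z b) - mu (tri x y z) t d)
            + (D z (tri x y w) e + mu (tri x y w) t c
              - mu z t (D x y d + mu y w a - mu x w b))
            + (D z w (D x y e + mu y t a - mu x t b) + mu w (tri x y t) c - mu z (tri x y t) d)"
        by (simp only: D_linear_rules mu_linear_rules D_derivation [of x y z w]
            D_mu mu_of_tri_right [of y z w] mu_of_tri_right [of x z w]) (simp add: algebra_simps)
      then show ?thesis
        \<comment> \<open>Instantiated, since \<open>tri_tri\<close> also applies to its own last summand.\<close>
        by (simp add: components tri_tri [of x y z w t])
    qed
  qed
qed

end

section \<open>Nijenhuis identities with values in operators\<close>

context nijenhuis_structure
begin

text \<open>
  The identity that a Nijenhuis structure demands of $\mu$, for an arbitrary operator-valued map: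
  it says that $F(x,y)v$ satisfies the ternary Nijenhuis identity with respect to $N$ in \<open>x\<close> and
  \<open>y\<close> and to $S$ in \<open>v\<close>.
\<close>

definition compatible :: "('g \<Rightarrow> 'g \<Rightarrow> 'v \<Rightarrow> 'v) \<Rightarrow> bool" where
  "compatible F \<longleftrightarrow> (\<forall>x y v. F (N x) (N y) (S v) =
      S (F (N x) y (S v) + F x (N y) (S v) + F (N x) (N y) v
        - S (F (N x) y v + F x (N y) v + F x y (S v))
        + S (S (F x y v))))"

lemmas S_linear_rules = linear_map_rules [OF linear_S]

lemma compatible_mu: "compatible mu"
  by (simp add: compatible_def mu_N)

lemma compatible_swap: "compatible F \<Longrightarrow> compatible (\<lambda>x y. F y x)"
  by (simp add: compatible_def add.commute)

lemma compatible_add: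
  "compatible F \<Longrightarrow> compatible G \<Longrightarrow> compatible (\<lambda>x y v. F x y v + G x y v)"
  by (simp add: compatible_def S_linear_rules algebra_simps)

lemma compatible_diff:
  "compatible F \<Longrightarrow> compatible G \<Longrightarrow> compatible (\<lambda>x y v. F x y v - G x y v)"
  by (simp only: compatible_def S_linear_rules) (simp add: algebra_simps)

text \<open>
  The hypothesis on $\rho$ lets $S$ pass leftwards through \<open>rho (N x)\<close>. Moving it through
  both factors of $\rho(Nx)\rho(Ny)S$ creates the terms \<open>rho x (S (rho y v))\<close>, in which $S$ stands
  between the factors; they occur with both signs and cancel.
\<close>

lemma compatible_rho_rho: "compatible (\<lambda>x y v. rho x (rho y v))"
  unfolding compatible_def
  by (simp add: rho_N S_linear_rules rho_linear_rules algebra_simps)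

text \<open>
  Here $[Nx,Ny]=N[x,y]_N$ makes the hypothesis on $\rho$ applicable to the element $[x,y]_N$. The
  term $-N[x,y]$ in $[x,y]_N$ yields $\rho(N[x,y])S$, to which the hypothesis is applied a second
  time; this produces the term in $S^3$.
\<close>

lemma compatible_rho_br: "compatible (\<lambda>x y. rho (br x y))"
  unfolding compatible_def
  by (simp add: br_N rho_N deformed_br_def S_linear_rules rho_linear_rules algebra_simps)

lemma compatible_D: "compatible D"
proof -
  have "compatible (\<lambda>x y v. mu y x v - mu x y v
      + (rho x (rho y v) - rho y (rho x v)) - rho (br x y) v)"
    by (intro compatible_add compatible_diff compatible_mu compatible_rho_rho compatible_rho_br
        compatible_swap [OF compatible_mu] compatible_swap [OF compatible_rho_rho])
  then show ?thesis
    by (simp add: rep_D_def [abs_def])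
qed

abbreviation NS :: "'g \<times> 'v \<Rightarrow> 'g \<times> 'v" where
  "NS \<equiv> \<lambda>(x, u). (N x, S u)"

lemma semidirect_br_NS:
  "semidirect_br br rho (NS (x, u)) (NS (y, v))
    = NS (deformed_br (semidirect_br br rho) NS (x, u) (y, v))"
  by (simp add: br_N rho_N deformed_br_def S_linear_rules algebra_simps)

text \<open>
  In the component in $V$, the hypothesis on $\mu$ covers the terms in \<open>u\<close> and \<open>v\<close>, the
  compatibility of $D$ the term in \<open>w\<close>.
\<close>

lemma semidirect_tri_NS:
  "semidirect_tri br tri rho mu (NS (x, u)) (NS (y, v)) (NS (z, w))
    = NS (deformed_tri (semidirect_tri br tri rho mu) NS (x, u) (y, v) (z, w))"
proof -
  have "D (N x) (N y) (S w) =
      S (D (N x) y (S w) + D x (N y) (S w) + D (N x) (N y) w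
        - S (D (N x) y w + D x (N y) w + D x y (S w))
        + S (S (D x y w)))"
    using compatible_D unfolding compatible_def by blast
  then show ?thesis
    by (simp add: tri_N mu_N deformed_tri_def S_linear_rules algebra_simps)
qed

end

theorem proposition3p14:
  fixes sg :: "'k::field_char_0 \<Rightarrow> 'g::ab_group_add \<Rightarrow> 'g"
    and br :: "'g \<Rightarrow> 'g \<Rightarrow> 'g"
    and tri :: "'g \<Rightarrow> 'g \<Rightarrow> 'g \<Rightarrow> 'g"
    and sv :: "'k \<Rightarrow> 'v::ab_group_add \<Rightarrow> 'v"
    and rho :: "'g \<Rightarrow> 'v \<Rightarrow> 'v"
    and mu :: "'g \<Rightarrow> 'g \<Rightarrow> 'v \<Rightarrow> 'v"
    and N :: "'g \<Rightarrow> 'g"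
    and S :: "'v \<Rightarrow> 'v"
  assumes "nijenhuis_structure sg br tri sv rho mu N S"
  shows "nijenhuis_operator (module_prod.scale sg sv)
    (semidirect_br br rho) (semidirect_tri br tri rho mu) (\<lambda>(x, u). (N x, S u))"
proof -
  interpret nijenhuis_structure sg br tri sv rho mu N S by fact
  interpret vector_space_prod sg sv ..
  interpret L: lie_yamaguti scale "semidirect_br br rho" "semidirect_tri br tri rho mu"
    by (rule lie_yamaguti_semidirect)
  show ?thesis
  proof (intro nijenhuis_operator.intro nijenhuis_operator_axioms.intro L.lie_yamaguti_axioms)
    show "Vector_Spaces.linear scale scale NS"
      by (auto simp: Vector_Spaces.linear_iff p.vector_space_axioms scale_prod
          linear_map_rules [OF linear_N] S_linear_rules)
    fix X Y Z :: "'g \<times> 'v"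
    show "semidirect_br br rho (NS X) (NS Y) = NS (deformed_br (semidirect_br br rho) NS X Y)"
      using semidirect_br_NS by (cases X, cases Y) simp
    show "semidirect_tri br tri rho mu (NS X) (NS Y) (NS Z)
        = NS (deformed_tri (semidirect_tri br tri rho mu) NS X Y Z)"
      using semidirect_tri_NS by (cases X, cases Y, cases Z) simp
  qed
qed

end
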